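(* Let $(\mathbf{X},Y_{\mathbf{X}},Y_{\mathbf{B}})$ be the instance, instance label and bag label random variables of a multiple instance learning problem (as described in the context), whose joint law satisfies (i) $P(Y_{\mathbf{X}}=0\mid Y_{\mathbf{B}}=0)=1$; (ii) $P(\mathbf{X}\mid Y_{\mathbf{X}},Y_{\mathbf{B}})=P(\mathbf{X}\mid Y_{\mathbf{X}})$; (iii) $P(\mathbf{X}\mid Y_{\mathbf{X}}=0)=P(\mathbf{X}\mid Y_{\mathbf{B}}=0)$; (iv) $P(Y_{\mathbf{X}}=1)=P(Y_{\mathbf{X}}=1,Y_{\mathbf{B}}=1)$. Let $L:\mathcal{C}\times\{0,1\}\to\mathbb{R}^+$ be a loss function, $f:\mathcal{X}\to\mathcal{C}\subseteq\mathbb{R}$ a classifier, and $R_L(f)=\mathbb{E}_{\mathbf{X},Y_{\mathbf{X}}}\,L(f(\boldsymbol{x}),y_{\boldsymbol{x}})$ its instance-level $L$-risk. Then $R_L(f)$ is unbiasedly estimated, without using instance labels, by $$\hat R^u_L(f)=\frac{1}{\sum_{\boldsymbol{b}\in S}|\boldsymbol{b}|}\sum_{\boldsymbol{b}\in S}\sum_{\boldsymbol{x}\in\boldsymbol{b}}L(f(\boldsymbol{x}),1)+\frac{P(Y_{\mathbf{X}}=0)}{\sum_{\boldsymbol{b}\in S^-}|\boldsymbol{b}|}\sum_{\boldsymbol{b}\in S^-}\sum_{\boldsymbol{x}\in\boldsymbol{b}}\bigl(L(f(\boldsymbol{x}),0)-L(f(\boldsymbol{x}),1)\bigr),$$ that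 is, $\mathbb{E}\bigl[\hat R^u_L(f)\bigr]=R_L(f)$, the expectation being over the sample.
   Context: Multiple instance learning: $\mathbf{X}\in\mathcal{X}\subset\mathbb{R}^d$ is an instance, $Y_{\mathbf{X}}\in\{0,1\}$ its (unobserved) label. A bag $\boldsymbol{b}$ is a finite collection of $|\boldsymbol{b}|$ instances with an observed bag label in $\{0,1\}$; $Y_{\mathbf{B}}$ denotes the label of the bag to which the instance $\mathbf{X}$ belongs. All instances in a negative bag (label $0$) are negative; a positive bag (label $1$) contains at least one positive instance. $S$ is the given finite set of labelled bags, and $S^-\subseteq S$ is the set of its negative bags. $P(\mathbf{X}\mid\cdot)$ denotes a conditional law of $\mathbf{X}$; events conditioned upon are assumed to have positive probability, and the expectations occurring are assumed finite. Sampling convention (i.i.d. assumption on instances): the pooled instances of all bags in $S$ are treated as an i.i.d. sample, of fixed positive size $\sum_{\boldsymbol{b}\in S}|\boldsymbol{b}|$, from the marginal law $P(\mathbf{X})$, and the pooled instances of the bags in $S^-$ are treated as an i.i.d. sample, of fixed positive size $\sum_{\boldsymbol{b}\in S^-}|\boldsymbol{b}|$, from $P(\mathbf{X}\mid Y_{\mathbf{B}}=0)$. Nothing is assumed about the joint dependence of these two samples. The number $P(Y_{\mathbf{X}}=0)$ is known. *)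

theory Defs
  imports "HOL-Probability.Probability"
begin

text \<open>
  Labels are Booleans throughout: \<^const>\<open>True\<close> is the label 1, \<^const>\<open>False\<close> the label 0.
  Bags and collections of bags are multisets, so that repeated instances and repeated bags are
  counted with their multiplicity in all sums and sizes.
\<close>

type_synonym 'x obs_bag = "'x multiset \<times> bool"

text \<open>A bag together with the hidden labels of its instances; the second component is the
  (observed) bag label.\<close>

type_synonym 'x bag = "('x \<times> bool) multiset \<times> bool"

definition mil_bag :: "'x bag \<Rightarrow> bool" where
  "mil_bag b \<longleftrightarrow>
     (\<not> snd b \<longrightarrow> (\<forall>p\<in>#fst b. \<not> snd p)) \<and>
     (snd b \<longrightarrow> (\<exists>p\<in>#fst b. snd p))"

definition observe :: "'x bag multiset \<Rightarrow> 'x obs_bag multiset" where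
  "observe S = image_mset (\<lambda>b. (image_mset fst (fst b), snd b)) S"

definition negative_bags :: "'x obs_bag multiset \<Rightarrow> 'x obs_bag multiset" where
  "negative_bags S = filter_mset (\<lambda>b. \<not> snd b) S"

definition pooled :: "'x obs_bag multiset \<Rightarrow> 'x multiset" where
  "pooled S = (\<Sum>b\<in>#S. fst b)"

text \<open>The instance space carries the trace of the Borel sets, so it need not be Borel itself.\<close>

abbreviation instance_space :: "(real ^ 'd) set \<Rightarrow> (real ^ 'd) measure" where
  "instance_space \<X> \<equiv> restrict_space borel \<X>"

text \<open>The conditional law of \<open>X\<close> given an event, meaningful for events of positive
  probability.\<close>

definition cond_law ::
    "'w measure \<Rightarrow> 'x measure \<Rightarrow> ('w \<Rightarrow> 'x) \<Rightarrow> ('w \<Rightarrow> bool) \<Rightarrow> 'x measure" where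
  "cond_law M N X P = distr (uniform_measure M {\<omega> \<in> space M. P \<omega>}) N X"

definition risk ::
    "'w measure \<Rightarrow> ('w \<Rightarrow> 'x) \<Rightarrow> ('w \<Rightarrow> bool) \<Rightarrow> (real \<Rightarrow> bool \<Rightarrow> real) \<Rightarrow> ('x \<Rightarrow> real) \<Rightarrow> real" where
  "risk M X YX L f = (\<integral>\<omega>. L (f (X \<omega>)) (YX \<omega>) \<partial>M)"

text \<open>The random multiset \<open>A\<close> consists of the values of \<open>n\<close> independent random variables with
  law \<open>Q\<close>. The enumeration of \<open>A\<close> by these variables is arbitrary; in particular it need not be
  tied to a fixed position in a fixed bag.\<close>

definition iid_sample :: "'s measure \<Rightarrow> 'x measure \<Rightarrow> nat \<Rightarrow> ('s \<Rightarrow> 'x multiset) \<Rightarrow> bool" where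
  "iid_sample \<Omega> Q n A \<longleftrightarrow>
     (\<exists>Z. prob_space.indep_vars \<Omega> (\<lambda>_. Q) Z {..<n} \<and>
          (\<forall>i<n. distr \<Omega> Q (Z i) = Q) \<and>
          (\<forall>\<omega>\<in>space \<Omega>. A \<omega> = image_mset (\<lambda>i. Z i \<omega>) (mset_set {..<n})))"

text \<open>
  The estimator as a function of all bags \<open>S\<close> and the negative bags \<open>N\<close>; on a single data set it
  is used with \<open>N = negative_bags S\<close>. The two arguments are separate because the two sampling
  assumptions (all instances i.i.d. from the marginal law, instances of negative bags i.i.d. from
  the law conditional on a negative bag) are an idealisation. If the negative bags are literally
  among the bags of the first sample, both assumptions cannot hold together when, for instance,
  some set of instances has positive marginal probability but conditional probability zero.
\<close>

definition risk_estimator ::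
    "(real \<Rightarrow> bool \<Rightarrow> real) \<Rightarrow> ('x \<Rightarrow> real) \<Rightarrow> real \<Rightarrow> 'x obs_bag multiset \<Rightarrow> 'x obs_bag multiset \<Rightarrow> real"
  where
  "risk_estimator L f p0 S N =
     1 / real (\<Sum>b\<in>#S. size (fst b)) * (\<Sum>b\<in>#S. \<Sum>x\<in>#fst b. L (f x) True) +
     p0 / real (\<Sum>b\<in>#N. size (fst b)) *
       (\<Sum>b\<in>#N. \<Sum>x\<in>#fst b. L (f x) False - L (f x) True)"

end

theory Submission
  imports Defs
begin

text \<open>
  Pointwise \<open>L(f X, Y\<^sub>X) = L(f X, 1) + 1[Y\<^sub>X = 0] (L(f X, 0) - L(f X, 1))\<close>. Taking
  expectations, the risk is the mean of \<open>L(f X, 1)\<close> plus \<open>P(Y\<^sub>X = 0)\<close> times the mean of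
  \<open>L(f X, 0) - L(f X, 1)\<close> under the law of \<open>X\<close> given \<open>Y\<^sub>X = 0\<close>, and by (iii) that law is the
  one from which the instances of negative bags are drawn. Each of the two averages in the
  estimator is unbiased for the corresponding mean.
\<close>

text \<open>Conditioning on an event of positive probability reweights \<open>M\<close> by the
  normalised indicator of that event. Integrability is asked only of the product with the indicator,
  so \<open>g (X \<omega>)\<close> may fail to be integrable off the event.\<close>

lemma integral_cond_law:
  fixes g :: "'x \<Rightarrow> real"
  assumes M: "prob_space M" and X: "X \<in> measurable M N"
    and P: "{\<omega> \<in> space M. P \<omega>} \<in> sets M" "\<P>(\<omega> in M. P \<omega>) > 0"
    and g: "g \<in> borel_measurable N"
    and int: "integrable M (\<lambda>\<omega>. indicator {\<omega> \<in> space M. P \<omega>} \<omega> * g (X \<omega>))"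
  shows "integrable (cond_law M N X P) g"
    and "\<P>(\<omega> in M. P \<omega>) * (\<integral>x. g x \<partial>cond_law M N X P) =
           (\<integral>\<omega>. indicator {\<omega> \<in> space M. P \<omega>} \<omega> * g (X \<omega>) \<partial>M)"
proof -
  interpret prob_space M by fact
  let ?A = "{\<omega> \<in> space M. P \<omega>}"
  let ?d = "\<lambda>\<omega>. indicator ?A \<omega> / prob ?A"
  \<comment> \<open>Since the event has positive probability, the extended quotient defining the
    uniform measure is a finite real quotient. The density is thus real-valued, as the integral
    rules for real densities require.\<close>
  have uniform: "uniform_measure M ?A = density M (\<lambda>\<omega>. ennreal (?d \<omega>))"
    unfolding uniform_measure_def
    using P by (intro density_cong) (auto simp: emeasure_eq_measure indicator_def divide_ennreal
        simp flip: ennreal_1)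
  have d: "?d \<in> borel_measurable M" "AE \<omega> in M. 0 \<le> ?d \<omega>"
    using P by auto
  have X': "X \<in> measurable (density M (\<lambda>\<omega>. ennreal (?d \<omega>))) N"
    using X by (simp cong: measurable_cong_sets)
  have gX: "(\<lambda>\<omega>. g (X \<omega>)) \<in> borel_measurable M"
    using X g by measurable
  \<comment> \<open>The normalising constant is pulled out, leaving the integrand of
    \<open>int\<close>; multiplying by \<open>prob ?A\<close> cancels it at the end.\<close>
  have scale: "?d \<omega> * g (X \<omega>) = (1 / prob ?A) * (indicator ?A \<omega> * g (X \<omega>))" for \<omega>
    by simp
  show "integrable (cond_law M N X P) g"
    unfolding cond_law_def uniform integrable_distr_eq[OF X' g]
      integrable_real_density[OF d gX] scale
    using int by (rule integrable_mult_right)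
  have "(\<integral>x. g x \<partial>cond_law M N X P) = (\<integral>\<omega>. ?d \<omega> * g (X \<omega>) \<partial>M)"
    unfolding cond_law_def uniform integral_distr[OF X' g] integral_real_density[OF d gX] ..
  then show "prob ?A * (\<integral>x. g x \<partial>cond_law M N X P) =
      (\<integral>\<omega>. indicator ?A \<omega> * g (X \<omega>) \<partial>M)"
    unfolding scale using P by simp
qed

lemma size_iid_sample:
  assumes "iid_sample \<Omega> Q n A" "\<omega> \<in> space \<Omega>"
  shows "size (A \<omega>) = n"
  using assms by (auto simp: iid_sample_def)

text \<open>Every draw has law \<open>Q\<close>, so a change of variables gives each of the
  \<open>n\<close> summands the same mean, and linearity adds them up.\<close>

lemma integral_iid_sample:
  fixes g :: "'x \<Rightarrow> real"
  assumes "prob_space \<Omega>" and iid: "iid_sample \<Omega> Q n A" and g: "integrable Q g"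
  shows "integrable \<Omega> (\<lambda>\<omega>. \<Sum>x\<in>#A \<omega>. g x)"
    and "(\<integral>\<omega>. (\<Sum>x\<in>#A \<omega>. g x) \<partial>\<Omega>) = real n * (\<integral>x. g x \<partial>Q)"
proof -
  interpret prob_space \<Omega> by fact
  obtain Z where indep: "indep_vars (\<lambda>_. Q) Z {..<n}"
    and law: "\<And>i. i < n \<Longrightarrow> distr \<Omega> Q (Z i) = Q"
    and A: "\<And>\<omega>. \<omega> \<in> space \<Omega> \<Longrightarrow> A \<omega> = image_mset (\<lambda>i. Z i \<omega>) (mset_set {..<n})"
    using iid by (auto simp: iid_sample_def)
  have Z: "Z i \<in> measurable \<Omega> Q" if "i < n" for i
    using indep that by (auto simp: indep_vars_def)
  \<comment> \<open>The enumeration \<open>Z\<close> turns a sum over a random multiset into one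
    over a fixed index set, which can be exchanged with the integral.\<close>
  have sum: "(\<Sum>x\<in>#A \<omega>. g x) = (\<Sum>i<n. g (Z i \<omega>))" if "\<omega> \<in> space \<Omega>" for \<omega>
    using A[OF that] by (simp add: image_mset.compositionality o_def sum_unfold_sum_mset)
  have int: "integrable \<Omega> (\<lambda>\<omega>. g (Z i \<omega>))" if "i < n" for i
    using integrable_distr[OF Z[OF that], of g] law[OF that] g by simp
  have mean: "(\<integral>\<omega>. g (Z i \<omega>) \<partial>\<Omega>) = (\<integral>x. g x \<partial>Q)" if "i < n" for i
    using integral_distr[OF Z[OF that] borel_measurable_integrable[OF g]] law[OF that] by simp
  show "integrable \<Omega> (\<lambda>\<omega>. \<Sum>x\<in>#A \<omega>. g x)"
    using int by (subst Bochner_Integration.integrable_cong[OF refl sum]) auto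
  show "(\<integral>\<omega>. (\<Sum>x\<in>#A \<omega>. g x) \<partial>\<Omega>) = real n * (\<integral>x. g x \<partial>Q)"
    using int mean
    by (subst Bochner_Integration.integral_cong[OF refl sum]) (auto simp: Bochner_Integration.integral_sum)
qed

text \<open>The estimator is written bag by bag, whereas the sampling hypotheses concern pooled
  instances; this and \<open>sum_pooled\<close> connect the two.\<close>

lemma size_pooled: "size (pooled S) = (\<Sum>b\<in>#S. size (fst b))"
  unfolding pooled_def by (induction S) auto

lemma sum_pooled:
  fixes g :: "'x \<Rightarrow> real"
  shows "(\<Sum>x\<in>#pooled S. g x) = (\<Sum>b\<in>#S. \<Sum>x\<in>#fst b. g x)"
  unfolding pooled_def by (induction S) auto

text \<open>In the application \<open>g y x\<close> is \<open>L (f x) y\<close>. The second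
  integrability hypothesis is separate because the first controls \<open>g True (X \<omega>)\<close>
  only where \<open>Y\<close> holds.\<close>

lemma risk_decomposition:
  fixes g :: "bool \<Rightarrow> 'x \<Rightarrow> real"
  assumes M: "prob_space M" and X: "X \<in> measurable M N" and Y: "Y \<in> measurable M (count_space UNIV)"
    and pos: "\<P>(\<omega> in M. \<not> Y \<omega>) > 0"
    and g: "\<And>y. g y \<in> borel_measurable N"
    and int: "integrable M (\<lambda>\<omega>. g (Y \<omega>) (X \<omega>))" "integrable M (\<lambda>\<omega>. g True (X \<omega>))"
  shows "integrable (cond_law M N X (\<lambda>\<omega>. \<not> Y \<omega>)) (\<lambda>x. g False x - g True x)"
    and "(\<integral>\<omega>. g (Y \<omega>) (X \<omega>) \<partial>M) = (\<integral>\<omega>. g True (X \<omega>) \<partial>M) +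
           \<P>(\<omega> in M. \<not> Y \<omega>) * (\<integral>x. g False x - g True x \<partial>cond_law M N X (\<lambda>\<omega>. \<not> Y \<omega>))"
proof -
  have neg: "{\<omega> \<in> space M. \<not> Y \<omega>} \<in> sets M"
    using Y by measurable
  have diff: "g (Y \<omega>) (X \<omega>) - g True (X \<omega>) =
      indicator {\<omega> \<in> space M. \<not> Y \<omega>} \<omega> * (g False (X \<omega>) - g True (X \<omega>))"
    if "\<omega> \<in> space M" for \<omega>
    using that by (cases "Y \<omega>") auto
  \<comment> \<open>Integrability is read off from the left side of \<open>diff\<close>:
    \<open>g False (X \<omega>)\<close> is controlled only where \<open>Y\<close> fails, so the
    right side cannot be split into two integrable terms without the indicator.\<close>
  have int_diff: "integrable M (\<lambda>\<omega>. indicator {\<omega> \<in> space M. \<not> Y \<omega>} \<omega> *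
      (g False (X \<omega>) - g True (X \<omega>)))"
    using Bochner_Integration.integrable_diff[OF int]
    by (subst Bochner_Integration.integrable_cong[OF refl diff[symmetric]]) auto
  have meas: "(\<lambda>x. g False x - g True x) \<in> borel_measurable N"
    using g by (intro borel_measurable_diff)
  show "integrable (cond_law M N X (\<lambda>\<omega>. \<not> Y \<omega>)) (\<lambda>x. g False x - g True x)"
    by (rule integral_cond_law(1)[OF M X neg pos meas int_diff])
  have "\<P>(\<omega> in M. \<not> Y \<omega>) * (\<integral>x. g False x - g True x \<partial>cond_law M N X (\<lambda>\<omega>. \<not> Y \<omega>)) =
      (\<integral>\<omega>. g (Y \<omega>) (X \<omega>) - g True (X \<omega>) \<partial>M)"
    unfolding integral_cond_law(2)[OF M X neg pos meas int_diff]
    by (rule Bochner_Integration.integral_cong[OF refl diff[symmetric]])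
  then show "(\<integral>\<omega>. g (Y \<omega>) (X \<omega>) \<partial>M) = (\<integral>\<omega>. g True (X \<omega>) \<partial>M) +
      \<P>(\<omega> in M. \<not> Y \<omega>) * (\<integral>x. g False x - g True x \<partial>cond_law M N X (\<lambda>\<omega>. \<not> Y \<omega>))"
    using int by simp
qed

theorem theorem1:
  fixes M :: "'w measure" and \<X> :: "(real ^ 'd) set"
    and X :: "'w \<Rightarrow> real ^ 'd" and YX YB :: "'w \<Rightarrow> bool"
    and C :: "real set" and L :: "real \<Rightarrow> bool \<Rightarrow> real" and f :: "real ^ 'd \<Rightarrow> real"
    and \<Omega> :: "'s measure" and S S' :: "'s \<Rightarrow> (real ^ 'd) bag multiset" and n m :: nat
  assumes "prob_space M"
    and "X \<in> measurable M (instance_space \<X>)"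
    and "YX \<in> measurable M (count_space UNIV)"
    and "YB \<in> measurable M (count_space UNIV)"
    and pos_X: "\<P>(\<omega> in M. \<not> YX \<omega>) > 0"
    and pos_B: "\<P>(\<omega> in M. \<not> YB \<omega>) > 0"
    and i: "\<P>(\<omega> in M. \<not> YX \<omega> \<bar> \<not> YB \<omega>) = 1"
    and ii: "\<And>y b. \<P>(\<omega> in M. YX \<omega> = y \<and> YB \<omega> = b) > 0 \<Longrightarrow>
           cond_law M (instance_space \<X>) X (\<lambda>\<omega>. YX \<omega> = y \<and> YB \<omega> = b) =
           cond_law M (instance_space \<X>) X (\<lambda>\<omega>. YX \<omega> = y)"
    and iii: "cond_law M (instance_space \<X>) X (\<lambda>\<omega>. \<not> YX \<omega>) =
           cond_law M (instance_space \<X>) X (\<lambda>\<omega>. \<not> YB \<omega>)"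
    and iv: "\<P>(\<omega> in M. YX \<omega>) = \<P>(\<omega> in M. YX \<omega> \<and> YB \<omega>)"
    and "f ` \<X> \<subseteq> C"
    and "\<And>c y. c \<in> C \<Longrightarrow> L c y \<ge> 0"
    and "\<And>y. (\<lambda>x. L (f x) y) \<in> borel_measurable (instance_space \<X>)"
    and "integrable M (\<lambda>\<omega>. L (f (X \<omega>)) (YX \<omega>))"
    and "integrable M (\<lambda>\<omega>. L (f (X \<omega>)) True)"
    and "prob_space \<Omega>"
    and "\<And>\<omega> b. \<omega> \<in> space \<Omega> \<Longrightarrow> b \<in># S \<omega> \<Longrightarrow> mil_bag b"
    and "\<And>\<omega> b. \<omega> \<in> space \<Omega> \<Longrightarrow> b \<in># S' \<omega> \<Longrightarrow> mil_bag b"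
    and "n > 0" and "m > 0"
    and "iid_sample \<Omega> (distr M (instance_space \<X>) X) n (\<lambda>\<omega>. pooled (observe (S \<omega>)))"
    and "iid_sample \<Omega> (cond_law M (instance_space \<X>) X (\<lambda>\<omega>. \<not> YB \<omega>)) m
           (\<lambda>\<omega>. pooled (negative_bags (observe (S' \<omega>))))"
  defines "p0 \<equiv> \<P>(\<omega> in M. \<not> YX \<omega>)"
  shows
    "(integrable \<Omega> (\<lambda>\<omega>. risk_estimator L f p0 (observe (S \<omega>)) (negative_bags (observe (S' \<omega>)))) \<and>
      (\<integral>\<omega>. risk_estimator L f p0 (observe (S \<omega>)) (negative_bags (observe (S' \<omega>))) \<partial>\<Omega>)
        = risk M X YX L f) \<and>
     (S' = S \<longrightarrow>
      integrable \<Omega> (\<lambda>\<omega>. risk_estimator L f p0 (observe (S \<omega>)) (negative_bags (observe (S \<omega>)))) \<and>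
      (\<integral>\<omega>. risk_estimator L f p0 (observe (S \<omega>)) (negative_bags (observe (S \<omega>))) \<partial>\<Omega>)
        = risk M X YX L f)"
proof -
  let ?N = "instance_space \<X>"
  let ?g = "\<lambda>y x. L (f x) y"
  let ?A = "\<lambda>\<omega>. pooled (observe (S \<omega>))"
  let ?B = "\<lambda>\<omega>. pooled (negative_bags (observe (S' \<omega>)))"
  let ?est = "\<lambda>\<omega>. risk_estimator L f p0 (observe (S \<omega>)) (negative_bags (observe (S' \<omega>)))"
  note X = assms(2) and g = assms(13) and int = assms(14,15) and \<Omega> = assms(16)
    and iid_all = assms(21) and iid_neg = assms(22)
  \<comment> \<open>Hypothesis \<open>iii\<close> replaces the law given a negative instance label,
    which is unobserved, by the law given a negative bag, from which the second sample is
    drawn.\<close>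
  note decomp = risk_decomposition[OF assms(1-3) pos_X g int, unfolded iii, folded p0_def]
  have "integrable (distr M ?N X) (?g True)"
    using integrable_distr_eq[OF X g] int by simp
  note sum_all = integral_iid_sample[OF \<Omega> iid_all this]
    and sum_neg = integral_iid_sample[OF \<Omega> iid_neg decomp(1)]
  \<comment> \<open>Both denominators are pooled sizes, hence the constants \<open>n\<close> and
    \<open>m\<close> at every sample point. The estimator is therefore a linear combination of two
    sample sums with deterministic coefficients.\<close>
  have est: "?est \<omega> = 1 / real n * (\<Sum>x\<in>#?A \<omega>. ?g True x) +
      p0 / real m * (\<Sum>x\<in>#?B \<omega>. ?g False x - ?g True x)" if "\<omega> \<in> space \<Omega>" for \<omega>
    unfolding risk_estimator_def size_pooled[symmetric] sum_pooled[symmetric]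
      size_iid_sample[OF iid_all that] size_iid_sample[OF iid_neg that] ..
  have "integrable \<Omega> ?est"
    using sum_all(1) sum_neg(1)
    by (subst Bochner_Integration.integrable_cong[OF refl est]) auto
  moreover have "(\<integral>\<omega>. ?est \<omega> \<partial>\<Omega>) =
      1 / real n * (\<integral>\<omega>. (\<Sum>x\<in>#?A \<omega>. ?g True x) \<partial>\<Omega>) +
      p0 / real m * (\<integral>\<omega>. (\<Sum>x\<in>#?B \<omega>. ?g False x - ?g True x) \<partial>\<Omega>)"
    using sum_all(1) sum_neg(1)
    by (subst Bochner_Integration.integral_cong[OF refl est]) auto
  then have "(\<integral>\<omega>. ?est \<omega> \<partial>\<Omega>) = risk M X YX L f"
    \<comment> \<open>The factors \<open>n\<close> and \<open>m\<close> from the sample sums cancel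
      the normalisations, as both are positive; the mean under the marginal law is pulled back to
      \<open>M\<close> along \<open>X\<close>.\<close>
    unfolding sum_all(2) sum_neg(2) risk_def decomp(2)
    using \<open>n > 0\<close> \<open>m > 0\<close> integral_distr[OF X g] by simp
  \<comment> \<open>The single data set case is the instance \<open>S' = S\<close> of what has been
    shown.\<close>
  ultimately show ?thesis by auto
qed

end
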